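(* There exist bi-Perron numbers arbitrarily close to $1$ and all of whose Galois conjugates are contained in $\mathbf{S}^1\cup\mathbf{R}_{>0}$. That is, for every $\delta>0$ there exists a bi-Perron number $\lambda$ with $1<\lambda<1+\delta$ such that all Galois conjugates of $\lambda$ are contained in $\mathbf{S}^1\cup\mathbf{R}_{>0}$.
   Context: A bi-Perron number $\lambda$ is a real algebraic unit $>1$ all of whose Galois conjugates (over $\mathbf{Q}$) have modulus in the open interval $(\lambda^{-1},\lambda)$, except for $\lambda$ itself and possibly one of $\pm\lambda^{-1}$. Here $\mathbf{S}^1\subset\mathbf{C}$ denotes the complex unit circle and $\mathbf{R}_{>0}$ the set of positive real numbers. *)

theory Defs
  imports "HOL-Computational_Algebra.Computational_Algebra" "HOL-Analysis.Analysis"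
begin

definition is_minimal_polynomial :: "rat poly \<Rightarrow> 'a :: field_char_0 \<Rightarrow> bool" where
  "is_minimal_polynomial p x \<longleftrightarrow>
     lead_coeff p = 1 \<and> irreducible p \<and> poly (map_poly of_rat p) x = 0"

text \<open>The set of conjugates contains \<open>x\<close> itself; it is empty if \<open>x\<close> is transcendental.\<close>

definition galois_conjugates :: "complex \<Rightarrow> complex set" where
  "galois_conjugates x =
     {z. \<exists>p. is_minimal_polynomial p x \<and> poly (map_poly of_rat p) z = 0}"

definition algebraic_unit :: "'a :: field_char_0 \<Rightarrow> bool" where
  "algebraic_unit x \<longleftrightarrow> x \<noteq> 0 \<and> algebraic_int x \<and> algebraic_int (inverse x)"

text \<open>
  The existential over \<open>\<mu>\<close> expresses that at most one of \<open>1 / l\<close> and \<open>- 1 / l\<close> is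
  allowed to occur as an exceptional conjugate.
\<close>

definition bi_Perron :: "real \<Rightarrow> bool" where
  "bi_Perron l \<longleftrightarrow> algebraic_unit l \<and> l > 1 \<and>
     (\<exists>\<mu> \<in> {inverse l, - inverse l}.
        \<forall>z \<in> galois_conjugates (of_real l) - {of_real l, of_real \<mu>}.
          cmod z \<in> {inverse l<..<l})"

end

theory Submission
  imports Defs "HOL-Computational_Algebra.Field_as_Ring"
begin

text \<open>
  The substitution \<open>s = \<lambda> + 1/\<lambda> + 2\<close> maps \<open>S\<^sup>1 \<union> \<real>\<^sub>>\<^sub>0\<close>
  into \<open>[0, \<infinity>)\<close>, and \<open>\<lambda>\<close> is close to \<open>1\<close> when \<open>s\<close> is close to \<open>4\<close>. It therefore
  suffices to find, for each \<open>\<kappa> = 1 + 1/b\<close>, a monic integer polynomial all of whose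
  complex roots lie in the real interval \<open>(0, 4\<kappa>)\<close>, with at least one root beyond \<open>4\<close>.
  If \<open>s\<close> is the largest root, and \<open>\<lambda> > 1\<close> solves \<open>\<lambda> + 1/\<lambda> + 2 = s\<close>, then each conjugate
  \<open>z\<close> of \<open>\<lambda>\<close> gives a root \<open>z + 1/z + 2\<close> in \<open>(0, s]\<close>; so \<open>z\<close> is either unimodular or
  a real number in \<open>[1/\<lambda>, \<lambda>]\<close>, with the end points as the admissible exceptions in the
  bi-Perron condition. The polynomial may be reducible: the conjugates are among the roots
  of any rational polynomial that vanishes at \<open>\<lambda>\<close>.

  Such polynomials exist by an argument of Robinson, because the interval has length
  greater than \<open>4\<close>. The polynomial \<open>F\<^sub>n\<close> obtained by scaling the Chebyshev polynomial to
  \<open>[0, 4\<kappa>]\<close> is monic and alternates between \<open>\<plusminus> 2\<kappa>\<^sup>n\<close> at \<open>n + 1\<close> points. Its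
  coefficients are only rational. Those below degree \<open>n - m\<close> are made integral by
  subtracting multiples \<open>r\<^sub>k F\<^sub>k\<close> with \<open>0 \<le> r\<^sub>k \<le> 1\<close>, which costs at most
  \<open>\<Sum>k<n-m. 2\<kappa>\<^sup>k < 2 \<kappa>\<^sup>n\<^sup>-\<^sup>m b\<close>; this stays below \<open>2\<kappa>\<^sup>n\<close> once \<open>\<kappa>\<^sup>m > b\<close>, so the
  alternation survives and yields \<open>n\<close> real roots (\<open>roots_of_alternating_poly\<close>). The \<open>m\<close>
  coefficients just below the leading one must not be touched: correcting them would cost
  too much. They are already integral if \<open>n\<close> is divisible by \<open>m! b\<^sup>m\<close>, because
  \<open>n\<close> divides \<open>j\<close> times the \<open>j\<close>-th coefficient from the top of the integral
  Chebyshev polynomial of degree \<open>n\<close> (\<open>dvd_coeff_cheb_shift\<close>).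
\<close>

section \<open>Integral Chebyshev polynomials on the interval from 0 to 4\<close>

text \<open>
  The polynomial expressing \<open>w\<^sup>n + w\<^sup>-\<^sup>n\<close> in terms of \<open>w + 1/w + 2\<close>. The shift by \<open>2\<close>
  puts the left end of the interval at \<open>0\<close>, so that enlarging the interval is a scaling,
  under which the coefficients change only by powers of the scaling factor.
\<close>


fun cheb_shift :: "nat \<Rightarrow> 'a::comm_ring_1 poly" where
  "cheb_shift 0 = [:2:]"
| "cheb_shift (Suc 0) = [:-2, 1:]"
| "cheb_shift (Suc (Suc n)) = [:-2, 1:] * cheb_shift (Suc n) - cheb_shift n"

text \<open>
  The sequence \<open>(w\<^sup>n - w\<^sup>-\<^sup>n) / (w - w\<^sup>-\<^sup>1)\<close> in the same variable, which occurs in the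
  derivative of the first.
\<close>

fun cheb_second :: "nat \<Rightarrow> 'a::comm_ring_1 poly" where
  "cheb_second 0 = 0"
| "cheb_second (Suc 0) = 1"
| "cheb_second (Suc (Suc n)) = [:-2, 1:] * cheb_second (Suc n) - cheb_second n"

lemma coeff_cheb_shift_of_int:
  "coeff (cheb_shift n :: 'a::comm_ring_1 poly) i = of_int (coeff (cheb_shift n) i)"
  by (induction n arbitrary: i rule: cheb_shift.induct)
     (auto simp: coeff_pCons algebra_simps split: nat.splits)

lemma coeff_cheb_shift_gt: "n < i \<Longrightarrow> coeff (cheb_shift n) i = 0"
  by (induction n arbitrary: i rule: cheb_shift.induct)
     (auto simp: coeff_pCons split: nat.splits)

lemma coeff_cheb_shift_top: "0 < n \<Longrightarrow> coeff (cheb_shift n) n = 1"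
proof (induction n rule: cheb_shift.induct)
  case (3 n)
  then show ?case by (simp add: coeff_cheb_shift_gt)
qed simp_all

lemma poly_cheb_shift_cos:
  "poly (cheb_shift n) (2 + 2 * cos t) = 2 * cos (real n * t)"
proof (induction n rule: cheb_shift.induct)
  case (3 n)
  have "cos (real (Suc (Suc n)) * t) + cos (real n * t) = 2 * cos t * cos (real (Suc n) * t)"
    using cos_add[of "real (Suc n) * t" t] cos_diff[of "real (Suc n) * t" t]
    by (simp add: algebra_simps)
  with 3 show ?case by (simp add: algebra_simps)
qed simp_all

lemma cheb_shift_eq_diff_cheb_second:
  "cheb_shift (Suc n) = cheb_second (Suc (Suc n)) - cheb_second n"
proof (induction n rule: cheb_second.induct)
  case (3 n)
  then show ?case
    by (simp only: cheb_shift.simps(3)) (simp add: algebra_simps smult_diff_right)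
qed (simp_all add: numeral_poly)

text \<open>
  Since \<open>w\<^sup>n + w\<^sup>-\<^sup>n\<close> is a sum of \<open>n\<close>-th powers, its derivative carries a factor \<open>n\<close>.
  This is the source of the divisibility of the coefficients below.
\<close>

lemma pderiv_cheb_shift:
  "pderiv (cheb_shift n :: int poly) = of_nat n * cheb_second n"
proof (induction n rule: cheb_shift.induct)
  case (3 n)
  have "pderiv (cheb_shift (Suc (Suc n)) :: int poly)
      = cheb_shift (Suc n) + [:-2, 1:] * pderiv (cheb_shift (Suc n)) - pderiv (cheb_shift n)"
    by (simp only: cheb_shift.simps(3) pderiv_diff pderiv_mult) (simp add: pderiv_pCons)
  also have "\<dots> = of_nat (Suc (Suc n)) * cheb_second (Suc (Suc n))"
  proof -
    have "X * U1 - U0 - U0 + X * (of_nat (Suc n) * U1) - of_nat n * U0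
        = of_nat (Suc (Suc n)) * (X * U1 - U0)" for X U0 U1 :: "int poly"
      by (simp only: of_nat_Suc) (simp add: algebra_simps del: mult_pCons_left mult_pCons_right)
    then show ?thesis
      unfolding 3 unfolding cheb_shift_eq_diff_cheb_second cheb_second.simps(3) .
  qed
  finally show ?case .
qed (simp_all add: pderiv_pCons)

text \<open>
  Comparing coefficients in the derivative, \<open>n\<close> divides \<open>(n - j)\<close> times the coefficient
  of degree \<open>n - j\<close>, and \<open>n - j \<equiv> -j\<close> modulo \<open>n\<close>.
\<close>

lemma dvd_coeff_cheb_shift:
  assumes "j \<le> n"
  shows "int n dvd int j * coeff (cheb_shift n) (n - j)"
proof -
  have "int n dvd int (n - j) * coeff (cheb_shift n) (n - j)"
  proof (cases "n - j")
    case (Suc i)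
    have "coeff (pderiv (cheb_shift n :: int poly)) i = int n * coeff (cheb_second n) i"
      by (simp add: pderiv_cheb_shift of_nat_poly)
    then show ?thesis by (metis Suc coeff_pderiv dvd_triv_left of_nat_eq_id id_apply)
  qed simp
  moreover have "int j * coeff (cheb_shift n) (n - j)
      = int n * coeff (cheb_shift n) (n - j) - int (n - j) * coeff (cheb_shift n) (n - j)"
    using assms by (simp add: of_nat_diff algebra_simps)
  ultimately show ?thesis by simp
qed

section \<open>Rounding to integer coefficients\<close>

text \<open>
  Rounding from the top down: subtracting a multiple of \<open>F N\<close> fixes the coefficient of
  degree \<open>N\<close>, and the later corrections by \<open>F k\<close> with \<open>k < N\<close> do not disturb it.
\<close>

lemma round_lower_coeffs:
  fixes A :: "real poly" and F :: "nat \<Rightarrow> real poly"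
  assumes "\<And>k. coeff (F k) k = 1" and "\<And>k i. k < i \<Longrightarrow> coeff (F k) i = 0"
  shows "\<exists>r. (\<forall>k. 0 \<le> r k \<and> r k \<le> 1) \<and>
     (\<forall>i<N. coeff (A - (\<Sum>k<N. smult (r k) (F k))) i \<in> \<int>) \<and>
     (\<forall>i\<ge>N. coeff (A - (\<Sum>k<N. smult (r k) (F k))) i = coeff A i)"
proof (induction N arbitrary: A)
  case 0
  show ?case by (intro exI[of _ "\<lambda>_. 0"]) auto
next
  case (Suc N)
  define c where "c = frac (coeff A N)"
  obtain r where r: "\<And>k. 0 \<le> r k \<and> r k \<le> 1"
    "\<And>i. i < N \<Longrightarrow> coeff (A - smult c (F N) - (\<Sum>k<N. smult (r k) (F k))) i \<in> \<int>"
    "\<And>i. N \<le> i \<Longrightarrow> coeff (A - smult c (F N) - (\<Sum>k<N. smult (r k) (F k))) i = coeff (A - smult c (F N)) i"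
    using Suc.IH[of "A - smult c (F N)"] by blast
  have eq: "A - (\<Sum>k<Suc N. smult ((r(N := c)) k) (F k))
      = A - smult c (F N) - (\<Sum>k<N. smult (r k) (F k))"
    by simp
  have N: "coeff (A - smult c (F N)) N \<in> \<int>"
    by (simp add: assms c_def frac_def)
  show ?case
  proof (intro exI[of _ "r(N := c)"] conjI allI impI)
    fix k show "0 \<le> (r(N := c)) k" "(r(N := c)) k \<le> 1"
      using r(1) by (auto simp: c_def less_imp_le[OF frac_lt_1])
  next
    fix i assume "i < Suc N"
    then show "coeff (A - (\<Sum>k<Suc N. smult ((r(N := c)) k) (F k))) i \<in> \<int>"
      unfolding eq using r(2)[of i] r(3)[of i] N by (cases "i = N") auto
  next
    fix i assume "Suc N \<le> i"
    then show "coeff (A - (\<Sum>k<Suc N. smult ((r(N := c)) k) (F k))) i = coeff A i"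
      unfolding eq using r(3)[of i] assms(2)[of N i] by simp
  qed
qed

text \<open>
  The exponent \<open>m\<close> in the proof is chosen so that the total rounding error is below the
  amplitude \<open>2\<kappa>\<^sup>n\<close>. Then \<open>n\<close> is taken to be a multiple of \<open>m! b\<^sup>m\<close>: a coefficient
  \<open>j \<le> m\<close> places from the top is \<open>\<kappa>\<^sup>j = ((b + 1) / b)\<^sup>j\<close> times an integer \<open>g\<close> with
  \<open>n dvd j * g\<close>, and the factor \<open>m!\<close> absorbs \<open>j\<close>, so that \<open>b\<^sup>m\<close> divides \<open>g\<close>.
\<close>

lemma integer_poly_near_scaled_cheb:
  assumes b: "0 < b"
  defines "\<kappa> \<equiv> 1 + 1 / real b"
  shows "\<exists>n\<ge>N. \<exists>P::int poly. degree P = n \<and> lead_coeff P = 1 \<and>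
     (\<forall>t. \<bar>poly (map_poly of_int P) (\<kappa> * (2 + 2 * cos t)) - 2 * \<kappa> ^ n * cos (real n * t)\<bar> < 2 * \<kappa> ^ n)"
proof -
  have k1: "\<kappa> > 1" using b by (simp add: \<kappa>_def)
  obtain m where m: "real b < \<kappa> ^ m" using real_arch_pow[OF k1] by blast
  define n where "n = fact m * b ^ m * (N + m + 1)"
  have "1 * (N + m + 1) \<le> n"
    unfolding n_def by (rule mult_right_mono) (use b in auto)
  then have n: "n > m" "n \<ge> N" by auto
  \<comment> \<open>The constant \<open>2\<close> that opens the Chebyshev sequence is not monic, so degree \<open>0\<close> is exceptional.\<close>
  define F :: "nat \<Rightarrow> real poly" where
    "F = (\<lambda>k. if k = 0 then 1 else smult (\<kappa> ^ k) (pcompose (cheb_shift k) [:0, 1 / \<kappa>:]))"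
  have coeff_F: "coeff (F k) i = \<kappa> ^ k * ((1 / \<kappa>) ^ i * coeff (cheb_shift k) i)" if "0 < k" for k i
    using that by (simp add: F_def coeff_pcompose_linear)
  have F_top: "coeff (F k) k = 1" for k
    using k1 by (cases "k = 0") (simp_all add: F_def coeff_F coeff_cheb_shift_top coeff_pcompose_linear power_one_over)
  have F_gt: "coeff (F k) i = 0" if "k < i" for k i
  proof (cases "k = 0")
    case False
    with that show ?thesis by (simp add: coeff_F coeff_cheb_shift_gt)
  qed (use that in \<open>simp add: F_def\<close>)
  have F_val: "poly (F k) (\<kappa> * (2 + 2 * cos t)) = 2 * \<kappa> ^ k * cos (real k * t)" if "0 < k" for k t
    using that k1 by (simp add: F_def poly_pcompose poly_cheb_shift_cos)
  have F_bound: "\<bar>poly (F k) (\<kappa> * (2 + 2 * cos t))\<bar> \<le> 2 * \<kappa> ^ k" for k t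
  proof (cases "k = 0")
    case False
    have "\<bar>cos (real k * t)\<bar> \<le> 1" by simp
    then have "2 * \<kappa> ^ k * \<bar>cos (real k * t)\<bar> \<le> 2 * \<kappa> ^ k * 1"
      by (rule mult_left_mono) (use k1 in simp)
    with False k1 show ?thesis by (simp add: F_val abs_mult)
  qed (simp add: F_def)
  have top: "coeff (F n) i \<in> \<int>" if i: "n - m \<le> i" for i
  proof (cases "i < n")
    case True
    define j where "j = n - i"
    have j: "0 < j" "j \<le> m" "j \<le> n" "i = n - j" using True i n by (auto simp: j_def)
    define g :: int where "g = coeff (cheb_shift n) i"
    have "int n dvd int j * g" unfolding g_def j(4) using j(3) by (rule dvd_coeff_cheb_shift)
    moreover obtain f where f: "fact m = j * f" using j dvd_fact[of j m] by (auto elim: dvdE)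
    have "int n = int j * (int b ^ m * (int f * (N + m + 1)))"
      by (simp add: n_def f algebra_simps)
    ultimately have "int b ^ m * (int f * (N + m + 1)) dvd g"
      using j(1) by simp
    then have "int b ^ m dvd g" by (rule dvd_mult_left)
    then have "int b ^ j dvd g" using j(2) le_imp_power_dvd dvd_trans by blast
    then obtain h where h: "g = int b ^ j * h" by (auto elim: dvdE)
    have "\<kappa> ^ n = \<kappa> ^ i * \<kappa> ^ j" using True by (simp add: j_def flip: power_add)
    then have "coeff (F n) i = \<kappa> ^ j * of_int g"
      using n k1 coeff_cheb_shift_of_int[of n i, where 'a = real]
      by (simp add: coeff_F g_def power_one_over)
    also have "\<dots> = (\<kappa> * real b) ^ j * of_int h" by (simp add: h power_mult_distrib)
    also have "\<kappa> * real b = real (b + 1)" using b by (simp add: \<kappa>_def field_simps)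
    finally show ?thesis by simp
  qed (metis F_gt F_top Ints_0 Ints_1 linorder_neqE_nat)
  obtain r where r: "\<And>k. 0 \<le> r k \<and> r k \<le> 1"
    "\<And>i. i < n - m \<Longrightarrow> coeff (F n - (\<Sum>k<n-m. smult (r k) (F k))) i \<in> \<int>"
    "\<And>i. n - m \<le> i \<Longrightarrow> coeff (F n - (\<Sum>k<n-m. smult (r k) (F k))) i = coeff (F n) i"
    using round_lower_coeffs[of F "n - m" "F n", OF F_top F_gt] by blast
  define A where "A = F n - (\<Sum>k<n-m. smult (r k) (F k))"
  have "coeff A i \<in> \<int>" for i
    unfolding A_def using r(2)[of i] r(3)[of i] top[of i] by (cases "i < n - m") auto
  then have floor_A: "of_int \<lfloor>coeff A i\<rfloor> = coeff A i" for i
    by (simp add: of_int_floor_cancel)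
  define P where "P = map_poly floor A"
  have P: "map_poly of_int P = A"
    by (rule poly_eqI) (simp add: P_def coeff_map_poly floor_A)
  have A_top: "coeff A n = 1" using r(3)[of n] by (simp add: A_def F_top)
  have A_gt: "coeff A i = 0" if "n < i" for i
    using r(3)[of i] that F_gt by (simp add: A_def)
  have degP: "degree P = n"
  proof (rule antisym)
    show "degree P \<le> n" by (rule degree_le) (simp add: P_def coeff_map_poly A_gt)
    show "n \<le> degree P" by (rule le_degree) (simp add: P_def coeff_map_poly A_top)
  qed
  have lcP: "lead_coeff P = 1" by (simp add: degP) (simp add: P_def coeff_map_poly A_top)
  have err: "\<bar>poly A (\<kappa> * (2 + 2 * cos t)) - 2 * \<kappa> ^ n * cos (real n * t)\<bar> < 2 * \<kappa> ^ n" for t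
  proof -
    let ?x = "\<kappa> * (2 + 2 * cos t)"
    have "\<bar>poly A ?x - 2 * \<kappa> ^ n * cos (real n * t)\<bar> = \<bar>\<Sum>k<n-m. r k * poly (F k) ?x\<bar>"
      using F_val[of n t] n by (simp add: A_def poly_sum)
    also have "\<dots> \<le> (\<Sum>k<n-m. \<bar>r k * poly (F k) ?x\<bar>)" by (rule sum_abs)
    also have "\<dots> \<le> (\<Sum>k<n-m. 2 * \<kappa> ^ k)"
    proof (rule sum_mono)
      fix k
      show "\<bar>r k * poly (F k) ?x\<bar> \<le> 2 * \<kappa> ^ k"
        using mult_mono[of "r k" 1 "\<bar>poly (F k) ?x\<bar>" "2 * \<kappa> ^ k"] r(1)[of k] F_bound[of k t]
        by (simp add: abs_mult)
    qed
    also have "\<dots> = 2 * ((\<kappa> ^ (n - m) - 1) * real b)"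
      using k1 b by (simp add: geometric_sum \<kappa>_def flip: sum_distrib_left)
    also have "(\<kappa> ^ (n - m) - 1) * real b \<le> (\<kappa> ^ (n - m) - 1) * \<kappa> ^ m"
      using m k1 by (intro mult_left_mono) auto
    also have "\<dots> = \<kappa> ^ n - \<kappa> ^ m"
      using n by (simp add: algebra_simps flip: power_add)
    also have "2 * (\<kappa> ^ n - \<kappa> ^ m) < 2 * \<kappa> ^ n" using k1 by simp
    finally show ?thesis by simp
  qed
  show ?thesis
    using n(2) degP lcP err unfolding P[symmetric] by blast
qed

section \<open>Integer polynomials with all roots in an interval of length greater than 4\<close>

text \<open>
  At the points \<open>\<kappa> (2 + 2 cos (i\<pi>/n))\<close>, \<open>i \<le> n\<close>, the comparison function equals
  \<open>(-1)\<^sup>i 2\<kappa>\<^sup>n\<close>, so \<open>P\<close> has alternating signs there. The \<open>n\<close> roots found between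
  consecutive points exhaust the complex roots. The rightmost of them lies beyond the
  second point, which gives the first claim.
\<close>

lemma roots_of_alternating_poly:
  fixes P :: "int poly"
  assumes "0 < \<kappa>" and "lead_coeff P = 1" and "0 < degree P"
    and near: "\<And>t. \<bar>poly (map_poly of_int P) (\<kappa> * (2 + 2 * cos t))
      - 2 * \<kappa> ^ degree P * cos (real (degree P) * t)\<bar> < 2 * \<kappa> ^ degree P"
  shows "\<exists>x. \<kappa> * (2 + 2 * cos (pi / degree P)) < x \<and> poly (map_poly of_int P) x = (0::real)"
    and "poly (map_poly of_int P) z = (0::complex) \<Longrightarrow>
      \<exists>x. 0 < x \<and> x < 4 * \<kappa> \<and> z = of_real x"
proof -
  define n where "n = degree P"
  define A where "A = (map_poly of_int P :: real poly)"
  define s where "s i = \<kappa> * (2 + 2 * cos (real i * pi / real n))" for i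
  have n: "0 < n" using assms(3) by (simp add: n_def)
  have sgn: "0 < (-1) ^ i * poly A (s i)" for i
  proof -
    have "real n * (real i * pi / real n) = pi * real i" using n by simp
    then have "cos (real n * (real i * pi / real n)) = (-1) ^ i"
      by (simp only: cos_npi2)
    then have "\<bar>poly A (s i) - 2 * \<kappa> ^ n * (-1) ^ i\<bar> < 2 * \<kappa> ^ n"
      using near[of "real i * pi / real n"] by (simp add: s_def A_def n_def)
    then show ?thesis by (cases "even i") auto
  qed
  have mono: "s (Suc i) < s i" if "i < n" for i
  proof -
    have "cos (real (Suc i) * pi / real n) < cos (real i * pi / real n)"
      using that by (intro cos_monotone_0_pi) (simp_all add: divide_simps)
    with assms(1) show ?thesis by (simp add: s_def)
  qed
  have "\<exists>x. s (Suc i) < x \<and> x < s i \<and> poly A x = 0" if "i < n" for i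
  proof -
    have "poly A (s (Suc i)) * poly A (s i) < 0"
      using sgn[of i] sgn[of "Suc i"] by (cases "even i") (auto simp: mult_less_0_iff)
    then show ?thesis using poly_IVT[OF mono[OF that]] by blast
  qed
  then obtain x where x: "\<And>i. i < n \<Longrightarrow> s (Suc i) < x i \<and> x i < s i \<and> poly A (x i) = 0"
    by metis
  have s_anti: "s j \<le> s i" if "i \<le> j" "j \<le> n" for i j
    using that
  proof (induction j rule: dec_induct)
    case (step j)
    then show ?case using mono[of j] by simp
  qed simp
  have x_anti: "x j < x i" if "i < j" "j < n" for i j
    using x[of i] x[of j] s_anti[of "Suc i" j] that by simp
  have x_range: "0 < x i" "x i < 4 * \<kappa>" if "i < n" for i
    using x[OF that] s_anti[of 0 i] s_anti[of "Suc i" n] that n by (simp_all add: s_def)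
  show "\<exists>x. \<kappa> * (2 + 2 * cos (pi / degree P)) < x \<and> poly (map_poly of_int P) x = (0::real)"
    using x[of 0] n by (auto simp: s_def n_def A_def)
  assume z: "poly (map_poly of_int P) z = (0::complex)"
  let ?C = "map_poly of_int P :: complex poly"
  have degC: "degree ?C = n" by (simp add: n_def degree_map_poly)
  have C0: "?C \<noteq> 0" using n degC by auto
  have "inj_on (\<lambda>i. complex_of_real (x i)) {..<n}"
    by (rule inj_onI) (metis lessThan_iff linorder_neqE_nat of_real_eq_iff order_less_irrefl x_anti)
  then have card: "card ((\<lambda>i. complex_of_real (x i)) ` {..<n}) = n"
    by (simp add: card_image)
  have C_real: "poly ?C (of_real u) = of_real (poly A u)" for u
    by (simp add: A_def poly_altdef degree_map_poly coeff_map_poly)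
  have "(\<lambda>i. complex_of_real (x i)) ` {..<n} \<subseteq> {w. poly ?C w = 0}"
    using x by (auto simp: C_real)
  moreover have "card {w. poly ?C w = 0} \<le> n" "finite {w. poly ?C w = 0}"
    using card_poly_roots_bound[OF C0] poly_roots_finite[OF C0] by (simp_all add: degC)
  ultimately have "(\<lambda>i. complex_of_real (x i)) ` {..<n} = {w. poly ?C w = 0}"
    using card by (intro card_seteq) auto
  then obtain i where "i < n" "z = of_real (x i)" using z by auto
  then show "\<exists>x. 0 < x \<and> x < 4 * \<kappa> \<and> z = of_real x" using x_range by blast
qed

text \<open>
  As \<open>n\<close> grows, the second alternation point tends to the right end \<open>4\<kappa> > 4\<close>, which
  forces a root beyond \<open>4\<close>.
\<close>

lemma monic_integer_poly_roots_in_interval: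
  assumes "0 < b"
  defines "\<kappa> \<equiv> 1 + 1 / real b"
  shows "\<exists>P::int poly. lead_coeff P = 1 \<and>
    (\<exists>x>4. poly (map_poly of_int P) x = (0::real)) \<and>
    (\<forall>z. poly (map_poly of_int P) z = (0::complex) \<longrightarrow> (\<exists>x. 0 < x \<and> x < 4 * \<kappa> \<and> z = of_real x))"
proof -
  have k1: "\<kappa> > 1" using assms by simp
  have "(\<lambda>n. \<kappa> * (2 + 2 * cos (pi / real n))) \<longlonglongrightarrow> \<kappa> * (2 + 2 * cos 0)"
    by (intro tendsto_intros lim_const_over_n)
  then have "\<forall>\<^sub>F n in sequentially. 4 < \<kappa> * (2 + 2 * cos (pi / real n))"
    by (rule order_tendstoD(1)) (use k1 in simp)
  then obtain N where N: "\<And>n. n \<ge> N \<Longrightarrow> 4 < \<kappa> * (2 + 2 * cos (pi / real n))"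
    by (auto simp: eventually_sequentially)
  obtain P :: "int poly" where P: "degree P \<ge> max N 1" "lead_coeff P = 1"
    "\<And>t. \<bar>poly (map_poly of_int P) (\<kappa> * (2 + 2 * cos t))
      - 2 * \<kappa> ^ degree P * cos (real (degree P) * t)\<bar> < 2 * \<kappa> ^ degree P"
    using integer_poly_near_scaled_cheb[OF assms(1), of "max N 1"] unfolding \<kappa>_def by blast
  have pos: "0 < \<kappa>" "0 < degree P" using k1 P(1) by auto
  show ?thesis
  proof (intro exI[of _ P] conjI allI impI)
    show "\<exists>x>4. poly (map_poly of_int P) x = (0::real)"
      using roots_of_alternating_poly(1)[OF pos(1) P(2) pos(2) P(3)] N[of "degree P"] P(1)
      by (meson less_trans max.boundedE)
  qed (use P(2) roots_of_alternating_poly(2)[OF pos(1) P(2) pos(2) P(3)] in auto)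
qed


section \<open>From traces to reciprocal polynomials and Galois conjugates\<close>

lemma map_poly_hom_mult:
  fixes h :: "'a::comm_ring_1 \<Rightarrow> 'b::comm_ring_1"
  assumes "h 0 = 0" "\<And>x y. h (x + y) = h x + h y" "\<And>x y. h (x * y) = h x * h y"
  shows "map_poly h (p * q) = map_poly h p * map_poly h q"
proof (rule poly_eqI)
  fix i
  have "h (sum f A) = (\<Sum>x\<in>A. h (f x))" for f and A :: "nat set"
    by (induction A rule: infinite_finite_induct) (simp_all add: assms)
  then show "coeff (map_poly h (p * q)) i = coeff (map_poly h p * map_poly h q) i"
    by (simp add: coeff_mult coeff_map_poly assms)
qed

lemma map_poly_hom_add:
  assumes "h 0 = 0" "\<And>x y. h (x + y) = h x + h y"
  shows "map_poly h (p + q) = map_poly h p + map_poly h q"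
  by (rule poly_eqI) (simp add: coeff_map_poly assms)

lemma irreducible_dvd_of_common_root:
  fixes p q :: "rat poly" and x :: "'a::field_char_0"
  assumes "irreducible p" "poly (map_poly of_rat p) x = 0" "poly (map_poly of_rat q) x = 0"
  shows "p dvd q"
proof (rule ccontr)
  assume "\<not> p dvd q"
  with assms(1) have "coprime p q"
    by (metis prime_elem_imp_coprime irreducible_imp_prime_elem_gcd)
  then obtain u v where "u * p + v * q = 1"
    by (metis bezout_coefficients_fst_snd coprime_imp_gcd_eq_1)
  then have "poly (map_poly of_rat (u * p + v * q)) x = (1::'a)" by simp
  then show False
    by (simp add: map_poly_hom_add map_poly_hom_mult of_rat_add of_rat_mult assms(2,3))
qed

text \<open>
  Clearing denominators in \<open>P (z + 1/z + 2)\<close>: since \<open>z + 1/z + 2 = (1 + z)\<^sup>2 / z\<close>, one takes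
  \<open>R = \<Sum>\<^sub>i p\<^sub>i X\<^sup>n\<^sup>-\<^sup>i (1 + X)\<^sup>2\<^sup>i\<close>. Only the term \<open>i = n\<close> reaches degree \<open>2n\<close>, and only this
  term is nonzero at \<open>0\<close>.
\<close>

lemma reciprocal_integer_poly:
  fixes P :: "int poly"
  assumes "lead_coeff P = 1"
  shows "\<exists>R::int poly. lead_coeff R = 1 \<and>
    (\<forall>z::'a::field_char_0. poly (map_poly of_int R) z = 0 \<longleftrightarrow>
       z \<noteq> 0 \<and> poly (map_poly of_int P) (z + inverse z + 2) = 0)"
proof -
  define n where "n = degree P"
  define T :: "nat \<Rightarrow> int poly" where
    "T i = smult (coeff P i) (monom 1 (n - i) * [:1, 1:] ^ (2 * i))" for i
  define R where "R = (\<Sum>i\<le>n. T i)"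
  have T_deg: "degree (T i) \<le> n + i" if "i \<le> n" for i
  proof -
    have "degree (T i) \<le> degree (monom (1::int) (n - i) * [:1, 1:] ^ (2 * i))"
      unfolding T_def by (rule degree_smult_le)
    also have "\<dots> \<le> (n - i) + 2 * i"
      using degree_mult_le[of "monom (1::int) (n - i)" "[:1, 1:] ^ (2 * i)"]
      by (simp add: degree_linear_power degree_monom_eq)
    finally show ?thesis using that by simp
  qed
  have "coeff R (2 * n) = (\<Sum>i\<le>n. if i = n then 1 else 0)"
    unfolding R_def coeff_sum
  proof (rule sum.cong)
    fix i assume "i \<in> {..n}"
    then consider "i < n" | "i = n" by fastforce
    then show "coeff (T i) (2 * n) = (if i = n then 1 else 0)"
    proof cases
      case 1
      with T_deg[of i] show ?thesis by (simp add: coeff_eq_0)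
    next
      case 2
      have "lead_coeff ([:1, 1:] ^ (2 * n) :: int poly) = 1"
        by (simp add: lead_coeff_power)
      then show ?thesis using 2 assms by (simp add: T_def n_def degree_linear_power)
    qed
  qed simp
  then have R_top: "coeff R (2 * n) = 1" by simp
  have "degree R \<le> 2 * n"
    unfolding R_def by (intro degree_sum_le) (use T_deg in fastforce)+
  then have "degree R = 2 * n" using le_degree[of R "2 * n"] R_top by simp
  with R_top have lc: "lead_coeff R = 1" by simp
  have iff: "poly (map_poly of_int R) z = 0 \<longleftrightarrow>
       z \<noteq> 0 \<and> poly (map_poly of_int P) (z + inverse z + 2) = 0" for z :: 'a
  proof -
    define e :: "int poly \<Rightarrow> 'a" where "e p = poly (map_poly of_int p) z" for p
    have e_add: "e (p + q) = e p + e q" and e_mult: "e (p * q) = e p * e q" for p q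
      by (simp_all add: e_def map_poly_hom_add map_poly_hom_mult)
    have e_0: "e 0 = 0" and e_1: "e 1 = 1" by (simp_all add: e_def)
    have e_sum: "e (\<Sum>i\<in>A. f i) = (\<Sum>i\<in>A. e (f i))" for f and A :: "nat set"
      by (induction A rule: infinite_finite_induct) (simp_all add: e_add e_0)
    have e_pow: "e (p ^ k) = e p ^ k" for p k
      by (induction k) (simp_all add: e_mult e_1)
    have e_T: "e (T i) = of_int (coeff P i) * (z ^ (n - i) * (1 + z) ^ (2 * i))" for i
    proof -
      have "T i = [:coeff P i:] * (monom 1 (n - i) * [:1, 1:] ^ (2 * i))"
        by (simp add: T_def)
      moreover have "e [:coeff P i:] = of_int (coeff P i)" "e (monom 1 (n - i)) = z ^ (n - i)"
          "e [:1, 1:] = 1 + z"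
        by (simp_all add: e_def map_poly_pCons map_poly_monom poly_monom)
      ultimately show ?thesis by (simp only: e_mult e_pow)
    qed
    have e_R: "e R = (\<Sum>i\<le>n. of_int (coeff P i) * (z ^ (n - i) * (1 + z) ^ (2 * i)))"
      by (simp add: R_def e_sum e_T)
    show ?thesis
    proof (cases "z = 0")
      case True
      have "e R = (\<Sum>i\<le>n. if i = n then 1 else 0)"
        unfolding e_R using True assms by (intro sum.cong) (auto simp: n_def power_0_left)
      with True show ?thesis by (simp add: e_def)
    next
      case False
      have "e R = (\<Sum>i\<le>n. z ^ n * (of_int (coeff P i) * (z + inverse z + 2) ^ i))"
        unfolding e_R
      proof (rule sum.cong)
        fix i assume "i \<in> {..n}"
        then have "z ^ n = z ^ (n - i) * z ^ i" by (simp flip: power_add)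
        moreover have "(1 + z) ^ (2 * i) = z ^ i * (z + inverse z + 2) ^ i"
        proof -
          have "(1 + z)\<^sup>2 = z * (z + inverse z + 2)"
            using False by (simp add: field_simps power2_eq_square)
          then show ?thesis by (simp only: power_mult power_mult_distrib)
        qed
        ultimately show "of_int (coeff P i) * (z ^ (n - i) * (1 + z) ^ (2 * i))
            = z ^ n * (of_int (coeff P i) * (z + inverse z + 2) ^ i)"
          by (simp add: ac_simps)
      qed simp
      also have "\<dots> = z ^ n * poly (map_poly of_int P) (z + inverse z + 2)"
        by (simp add: poly_altdef n_def degree_map_poly coeff_map_poly sum_distrib_left)
      finally show ?thesis using False by (simp add: e_def)
    qed
  qed
  show ?thesis using lc iff by blast
qed

text \<open>
  The imaginary part of \<open>z + 1/z\<close> is \<open>Im z (1 - 1/|z|\<^sup>2)\<close>, so a real trace forces \<open>z\<close> to be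
  real or unimodular; the bound \<open>-2 < t\<close> excludes negative real \<open>z\<close>.
\<close>

lemma trace_real_cases:
  fixes z :: complex
  assumes "z \<noteq> 0" "z + inverse z = of_real t" "-2 < t"
  shows "cmod z = 1 \<or> (\<exists>y>0. z = of_real y \<and> y + inverse y = t)"
proof (cases "Im z = 0")
  case True
  then obtain y where y: "z = of_real y" by (metis complex_is_Real_iff Reals_cases)
  with assms(1) have y0: "y \<noteq> 0" by auto
  have "of_real (y + inverse y) = (of_real t :: complex)" using assms(2) y by simp
  then have t: "y + inverse y = t" by (simp only: of_real_eq_iff)
  have "0 < y"
  proof (rule ccontr)
    assume "\<not> 0 < y"
    with y0 have "y < 0" by simp
    moreover have "y * inverse y = 1" using y0 by simp
    then have "(y + inverse y + 2) * y = (y + 1)\<^sup>2" by algebra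
    moreover have "0 < y + inverse y + 2" using t assms(3) by simp
    ultimately have "(y + 1)\<^sup>2 < 0" using mult_pos_neg by fastforce
    then show False by simp
  qed
  with y t show ?thesis by blast
next
  case False
  have "Im (z + inverse z) = 0" using assms(2) by simp
  then have "Im z * (1 - 1 / (cmod z)\<^sup>2) = 0"
    by (simp add: cmod_power2 algebra_simps)
  with False have "(cmod z)\<^sup>2 = 1\<^sup>2" by simp
  then show ?thesis by (metis norm_ge_zero power2_eq_imp_eq zero_le_one)
qed

lemma between_inverses:
  fixes l y :: real
  assumes "1 < l" "0 < y" "y + inverse y \<le> l + inverse l"
  shows "inverse l \<le> y \<and> y \<le> l"
proof -
  have "(y - l) * (y - inverse l) = y * ((y + inverse y) - (l + inverse l))"
  proof -
    have "l * inverse l = 1" "y * inverse y = 1" using assms(1,2) by simp_all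
    then show ?thesis by algebra
  qed
  also have "\<dots> \<le> 0" using assms by (intro mult_nonneg_nonpos) auto
  finally have "(y - l) * (y - inverse l) \<le> 0" .
  moreover have "inverse l < l" using assms(1) by (meson inverse_less_1_iff less_trans)
  ultimately show ?thesis by (auto simp: mult_le_0_iff)
qed

lemma galois_conjugate_root:
  fixes R :: "int poly"
  assumes "poly (map_poly of_int R) x = 0" "z \<in> galois_conjugates x"
  shows "poly (map_poly of_int R) z = 0"
proof -
  obtain p where p: "irreducible p" "poly (map_poly of_rat p) x = 0" "poly (map_poly of_rat p) z = 0"
    using assms(2) by (auto simp: galois_conjugates_def is_minimal_polynomial_def)
  define q where "q = (map_poly of_int R :: rat poly)"
  have q: "map_poly of_rat q = (map_poly of_int R :: complex poly)"
    by (simp add: q_def map_poly_map_poly o_def)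
  have "p dvd q" using irreducible_dvd_of_common_root[OF p(1,2)] assms(1) by (simp add: q)
  then obtain u where "q = p * u" by (auto elim: dvdE)
  then have "map_poly of_rat q = (map_poly of_rat p * map_poly of_rat u :: complex poly)"
    by (simp add: map_poly_hom_mult of_rat_add of_rat_mult)
  with p(3) show ?thesis by (simp add: q)
qed

section \<open>Bi-Perron numbers close to 1\<close>

theorem proposition2:
  shows "\<forall>\<delta>::real > 0. \<exists>l::real. bi_Perron l \<and> 1 < l \<and> l < 1 + \<delta> \<and>
           galois_conjugates (of_real l) \<subseteq> sphere 0 1 \<union> of_real ` {0<..}"
proof (intro allI impI)
  fix \<delta> :: real assume \<delta>: "0 < \<delta>"
  define u where "u = 1 + \<delta>"
  \<comment> \<open>The bound \<open>l < u\<close> amounts to \<open>l + 1/l < u + 1/u\<close>, and \<open>l + 1/l\<close> will be less than \<open>2 + 4/b\<close>.\<close>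
  have u: "1 < u" using \<delta> by (simp add: u_def)
  have "u + inverse u - 2 = \<delta>\<^sup>2 / u"
    using \<delta> by (simp add: u_def field_simps power2_eq_square)
  then have "0 < (u + inverse u - 2) / 4" using \<delta> u by simp
  then obtain b where b: "0 < b" "1 / real b < (u + inverse u - 2) / 4"
    by (metis inverse_eq_divide real_arch_inverse gr0I)
  obtain P :: "int poly" where P: "lead_coeff P = 1"
      "\<exists>x>4. poly (map_poly of_int P) x = (0::real)"
      "\<And>z. poly (map_poly of_int P) z = (0::complex) \<Longrightarrow>
         \<exists>x. 0 < x \<and> x < 4 * (1 + 1 / real b) \<and> z = of_real x"
    using monic_integer_poly_roots_in_interval[OF b(1)] by blast
  have P_real: "poly (map_poly of_int P) (complex_of_real x) = of_real (poly (map_poly of_int P) x)" for x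
    by (simp add: poly_altdef degree_map_poly coeff_map_poly)
  define S where "S = {x::real. poly (map_poly of_int P) x = 0}"
  have "(map_poly of_int P :: real poly) \<noteq> 0" using P(1) by (auto simp: map_poly_eq_0_iff)
  then have fin: "finite S" unfolding S_def by (rule poly_roots_finite)
  define s where "s = Max S"
  have "S \<noteq> {}" using P(2) by (auto simp: S_def)
  then have sS: "s \<in> S" unfolding s_def using fin by (rule Max_in[rotated])
  have s_max: "x \<le> s" if "x \<in> S" for x unfolding s_def using fin that by (rule Max_ge)
  have s4: "4 < s" using P(2) s_max by (fastforce simp: S_def)
  have s_le: "s < 4 * (1 + 1 / real b)"
    using P(3)[of "of_real s"] sS by (auto simp: S_def P_real)
  define t where "t = s - 2"
  define l where "l = (t + sqrt (t\<^sup>2 - 4)) / 2"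
  have t2: "2 < t" using s4 by (simp add: t_def)
  then have "2\<^sup>2 < t\<^sup>2" by (intro power_strict_mono) auto
  then have sq: "0 < sqrt (t\<^sup>2 - 4)" "(sqrt (t\<^sup>2 - 4))\<^sup>2 = t\<^sup>2 - 4" by auto
  have l1: "1 < l" using add_strict_mono[OF t2 sq(1)] by (simp add: l_def)
  have "2 * l = t + sqrt (t\<^sup>2 - 4)" by (simp add: l_def)
  with sq(2) have "l * (t - l) = 1" by algebra
  then have "inverse l = t - l" by (rule inverse_unique)
  then have lt: "l + inverse l = t" by simp
  have "l < u"
  proof (rule ccontr)
    assume "\<not> l < u"
    moreover have "l + inverse l < u + inverse u"
      using s_le b(2) by (simp add: lt t_def)
    ultimately show False using between_inverses[of l u] between_inverses[of u l] l1 u by auto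
  qed
  obtain R :: "int poly" where R: "lead_coeff R = 1"
      "\<And>z::complex. poly (map_poly of_int R) z = 0 \<longleftrightarrow>
         z \<noteq> 0 \<and> poly (map_poly of_int P) (z + inverse z + 2) = 0"
    using reciprocal_integer_poly[OF P(1)] by blast
  have "complex_of_real l + inverse (of_real l) + 2 = of_real (l + inverse l + 2)" by simp
  also have "l + inverse l + 2 = s" using lt by (simp add: t_def)
  finally have ls: "complex_of_real l + inverse (of_real l) + 2 = of_real s" .
  have Rl: "poly (map_poly of_int R) (complex_of_real l) = 0"
    using l1 sS by (simp add: R(2) ls P_real S_def)
  have Rl': "poly (map_poly of_int R) (complex_of_real (inverse l)) = 0"
    using l1 sS ls by (simp add: R(2) P_real S_def add.commute)
  have "algebraic_int (complex_of_real l)" "algebraic_int (complex_of_real (inverse l))"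
    using Rl Rl' R(1) by (auto simp: algebraic_int_altdef_ipoly)
  then have unit: "algebraic_unit l"
    using l1 by (simp add: algebraic_unit_def del: of_real_inverse)
  have conj: "cmod z = 1 \<or> (\<exists>y>0. z = of_real y \<and> inverse l \<le> y \<and> y \<le> l)"
    if z: "z \<in> galois_conjugates (of_real l)" for z
  proof -
    have z0: "z \<noteq> 0" and root: "poly (map_poly of_int P) (z + inverse z + 2) = 0"
      using galois_conjugate_root[OF Rl z] unfolding R(2) by blast+
    obtain x where x: "0 < x" "z + inverse z + 2 = of_real x"
      using P(3)[OF root] by blast
    have xS: "x \<in> S" using root unfolding x(2) P_real of_real_eq_0_iff S_def by simp
    have "z + inverse z = of_real (x - 2)" using x(2) by (simp add: algebra_simps)
    then consider "cmod z = 1" | y where "0 < y" "z = of_real y" "y + inverse y = x - 2"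
      using trace_real_cases[OF z0, of "x - 2"] x(1) by auto
    then show ?thesis
    proof cases
      case 2
      then have "y + inverse y \<le> l + inverse l" using s_max[OF xS] by (simp add: lt t_def)
      then show ?thesis using between_inverses[OF l1 2(1)] 2 by blast
    qed simp
  qed
  have l_inv: "inverse l < 1" using l1 by (simp add: inverse_less_1_iff)
  have "cmod z \<in> {inverse l<..<l}"
    if "z \<in> galois_conjugates (of_real l) - {of_real l, of_real (inverse l)}" for z
    using conj[of z] that l1 l_inv by (auto simp: order.strict_iff_order)
  then have "bi_Perron l" using unit l1 by (auto simp: bi_Perron_def)
  moreover have "galois_conjugates (of_real l) \<subseteq> sphere 0 1 \<union> of_real ` {0<..}"
    using conj by force
  ultimately show "\<exists>l::real. bi_Perron l \<and> 1 < l \<and> l < 1 + \<delta> \<and>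
           galois_conjugates (of_real l) \<subseteq> sphere 0 1 \<union> of_real ` {0<..}"
    using l1 \<open>l < u\<close> by (auto simp: u_def)
qed

end
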